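(* Let $\Gamma$ be a nonempty finite set, let $A\subseteq\Gamma$ be non-trivial (i.e. $A\ne\emptyset$ and $A\ne\Gamma$), and let $\mathcal B\subseteq\mathcal P(\Gamma)$ be a non-empty family of generators. Then $\rho(A,\mathcal B)\le D_\cap(A\mid\mathcal B)$.
   Context: A sequence $A_1,\dots,A_t$ ($t\ge1$) of subsets of $\Gamma$ generates $A$ from $\mathcal B$ if $A_t=A$ and each $A_i$ equals $X\cup Y$ or $X\cap Y$ for some (not necessarily distinct) $X,Y\in\mathcal B\cup\{A_1,\dots,A_{i-1}\}$. $D_\cap(A\mid\mathcal B)$ is the minimum number of intersection steps over all sequences generating $A$ from $\mathcal B$ ($\infty$ if none). Cover complexity: let $U=\Gamma\setminus A$. A semi-filter over $U$ is a nonempty family $\mathcal F\subseteq\mathcal P(U)$ with $\emptyset\notin\mathcal F$ such that $U_1\in\mathcal F$ and $U_1\subseteq U_2\subseteq U$ imply $U_2\in\mathcal F$. $\mathcal F$ is above $w\in\Gamma$ if for every $B\in\mathcal B$ with $w\in B$ we have $B\cap U\in\mathcal F$. $\mathcal F$ preserves a pair $(E,H)$ of subsets of $U$ if $E,H\in\mathcal F$ imply $E\cap H\in\mathcal F$; it preserves a collection $\Lambda$ if it preserves each pair. $\rho(A,\mathcal B)$ is the minimum size of a collection $\Lambda$ of pairs of subsets of $U$ such that no semi-filter over $U$ that preserves $\Lambda$ is above some $a\in A$ ($\infty$ if none exists). *)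

theory Defs
  imports "HOL-Library.Extended_Nat"
begin

text \<open>
  Each step of a generating sequence carries the operation that justifies it. A set that is
  both a union and an intersection of available sets (e.g. \<open>X = X \<union> X = X \<inter> X\<close>) is
  an intersection step only if it is labelled as such.
\<close>

datatype set_op = Cup | Cap

fun apply_op :: "set_op \<Rightarrow> 'a set \<Rightarrow> 'a set \<Rightarrow> 'a set" where
  "apply_op Cup X Y = X \<union> Y"
| "apply_op Cap X Y = X \<inter> Y"

definition generates :: "'a set \<Rightarrow> 'a set set \<Rightarrow> (set_op \<times> 'a set) list \<Rightarrow> 'a set \<Rightarrow> bool" where
  "generates \<Gamma> \<B> s A \<longleftrightarrow>
     s \<noteq> [] \<and> snd (last s) = A \<and>
     (\<forall>i<length s.
        snd (s ! i) \<subseteq> \<Gamma> \<and>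
        (\<exists>X \<in> \<B> \<union> snd ` set (take i s). \<exists>Y \<in> \<B> \<union> snd ` set (take i s).
           snd (s ! i) = apply_op (fst (s ! i)) X Y))"

definition num_caps :: "(set_op \<times> 'a set) list \<Rightarrow> nat" where
  "num_caps s = length (filter (\<lambda>p. fst p = Cap) s)"

text \<open>
  Both complexity measures are infima in \<^typ>\<open>enat\<close>: the infimum of a nonempty set is its
  minimum, and the infimum of the empty set is \<open>\<infinity>\<close>.
\<close>

definition D_cap :: "'a set \<Rightarrow> 'a set \<Rightarrow> 'a set set \<Rightarrow> enat" where
  "D_cap \<Gamma> A \<B> = Inf {enat (num_caps s) | s. generates \<Gamma> \<B> s A}"

definition semi_filter :: "'a set \<Rightarrow> 'a set set \<Rightarrow> bool" where
  "semi_filter U \<F> \<longleftrightarrow>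
     \<F> \<noteq> {} \<and> \<F> \<subseteq> Pow U \<and> {} \<notin> \<F> \<and>
     (\<forall>U1 U2. U1 \<in> \<F> \<and> U1 \<subseteq> U2 \<and> U2 \<subseteq> U \<longrightarrow> U2 \<in> \<F>)"

definition above :: "'a set \<Rightarrow> 'a set set \<Rightarrow> 'a set set \<Rightarrow> 'a \<Rightarrow> bool" where
  "above U \<B> \<F> w \<longleftrightarrow> (\<forall>B\<in>\<B>. w \<in> B \<longrightarrow> B \<inter> U \<in> \<F>)"

definition preserves :: "'a set set \<Rightarrow> ('a set \<times> 'a set) set \<Rightarrow> bool" where
  "preserves \<F> \<Lambda> \<longleftrightarrow> (\<forall>(E, H)\<in>\<Lambda>. E \<in> \<F> \<and> H \<in> \<F> \<longrightarrow> E \<inter> H \<in> \<F>)"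

definition cover_collection ::
  "'a set \<Rightarrow> 'a set \<Rightarrow> 'a set set \<Rightarrow> ('a set \<times> 'a set) set \<Rightarrow> bool" where
  "cover_collection \<Gamma> A \<B> \<Lambda> \<longleftrightarrow>
     \<Lambda> \<subseteq> Pow (\<Gamma> - A) \<times> Pow (\<Gamma> - A) \<and>
     \<not> (\<exists>\<F> a. semi_filter (\<Gamma> - A) \<F> \<and> preserves \<F> \<Lambda> \<and> a \<in> A \<and> above (\<Gamma> - A) \<B> \<F> a)"

definition cover_complexity :: "'a set \<Rightarrow> 'a set \<Rightarrow> 'a set set \<Rightarrow> enat" where
  "cover_complexity \<Gamma> A \<B> =
     Inf {enat (card \<Lambda>) | \<Lambda>. finite \<Lambda> \<and> cover_collection \<Gamma> A \<B> \<Lambda>}"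

end

theory Submission
  imports Defs
begin

text \<open>
  Tracing the operands of the intersection steps of a generating sequence on
  \<open>U = \<Gamma> - A\<close> gives the collection of pairs. If a semi-filter above some \<open>a \<in> A\<close>
  preserved these pairs, then, along the sequence, it would contain the trace of every
  generated set that contains \<open>a\<close>: union steps are absorbed by upward closure,
  intersection steps by preservation. Since the last set is \<open>A\<close>, its trace \<open>{}\<close> would
  lie in the semi-filter.
\<close>

text \<open>Strong induction along the sequence, since operands may come from any earlier step. The
  operands are functions \<open>X\<close>, \<open>Y\<close> of the index, and \<open>pres\<close>
  concerns only the traces of operands of steps labelled \<open>Cap\<close>, which is all that a
  collection with one pair per intersection step can provide.\<close>

lemma semi_filter_contains_traces:
  assumes sf: "semi_filter U \<F>" and ab: "above U \<B> \<F> a"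
    and step: "\<And>i. i < length s \<Longrightarrow>
      X i \<in> \<B> \<union> snd ` set (take i s) \<and> Y i \<in> \<B> \<union> snd ` set (take i s) \<and>
      snd (s ! i) = apply_op (fst (s ! i)) (X i) (Y i)"
    and pres: "\<And>i. \<lbrakk>i < length s; fst (s ! i) = Cap; X i \<inter> U \<in> \<F>; Y i \<inter> U \<in> \<F>\<rbrakk>
      \<Longrightarrow> (X i \<inter> U) \<inter> (Y i \<inter> U) \<in> \<F>"
    and "i < length s" and "a \<in> snd (s ! i)"
  shows "snd (s ! i) \<inter> U \<in> \<F>"
  using assms(5,6)
proof (induction i rule: less_induct)
  case (less i)
  \<comment> \<open>A generator is handled by \<open>above\<close>, an earlier set by the induction
    hypothesis.\<close>
  have avail: "Z \<inter> U \<in> \<F>" if "Z \<in> \<B> \<union> snd ` set (take i s)" and "a \<in> Z" for Z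
  proof (cases "Z \<in> \<B>")
    case True
    then show ?thesis using ab that(2) by (simp add: above_def)
  next
    case False
    then have "Z \<in> snd ` set (take i s)" using that(1) by blast
    then obtain p where p: "p \<in> set (take i s)" "Z = snd p" by blast
    obtain j where "j < length (take i s)" "take i s ! j = p"
      using p(1) unfolding in_set_conv_nth by blast
    then have "j < i" and "Z = snd (s ! j)" using p(2) by simp_all
    then show ?thesis using less.IH[of j] less.prems(1) that(2) by simp
  qed
  have up: "V \<inter> U \<in> \<F>" if "Z \<inter> U \<in> \<F>" and "Z \<subseteq> V" for Z V
  proof -
    have "Z \<inter> U \<subseteq> V \<inter> U" and "V \<inter> U \<subseteq> U" using that(2) by auto
    then show ?thesis using sf that(1) unfolding semi_filter_def by blast
  qed
  note st = step[OF less.prems(1)]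
  show ?case
  proof (cases "fst (s ! i)")
    case Cup
    then have eq: "snd (s ! i) = X i \<union> Y i" using st by simp
    \<comment> \<open>Only one operand need contain \<open>a\<close>; its trace lies below that of
      the union.\<close>
    consider "a \<in> X i" | "a \<in> Y i" using less.prems(2) eq by blast
    then show ?thesis
    proof cases
      case 1
      have "X i \<inter> U \<in> \<F>" by (rule avail[OF _ 1]) (use st in blast)
      then show ?thesis by (rule up) (simp add: eq)
    next
      case 2
      have "Y i \<inter> U \<in> \<F>" by (rule avail[OF _ 2]) (use st in blast)
      then show ?thesis by (rule up) (simp add: eq)
    qed
  next
    case Cap
    then have eq: "snd (s ! i) = X i \<inter> Y i" using st by simp
    then have "a \<in> X i" and "a \<in> Y i" using less.prems(2) by blast+
    then have "X i \<inter> U \<in> \<F>" and "Y i \<inter> U \<in> \<F>" using avail st by blast+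
    then have "(X i \<inter> U) \<inter> (Y i \<inter> U) \<in> \<F>" using pres less.prems(1) Cap by blast
    then show ?thesis unfolding eq by (simp add: Int_ac)
  qed
qed

text \<open>Each step labelled \<open>Cap\<close> contributes the traces of its two operands.
  Distinct steps may yield the same pair, hence only an inequality for the cardinality.\<close>

lemma generates_imp_cover_collection:
  assumes "generates \<Gamma> \<B> s A"
  obtains \<Lambda> where "finite \<Lambda>" and "cover_collection \<Gamma> A \<B> \<Lambda>" and "card \<Lambda> \<le> num_caps s"
proof -
  let ?U = "\<Gamma> - A"
  let ?I = "{i. i < length s \<and> fst (s ! i) = Cap}"
  \<comment> \<open>Both operands are packed into one pair so that a single choice fixes them for
    all steps at once.\<close>
  have "\<forall>i\<in>{..<length s}. \<exists>P.
      fst P \<in> \<B> \<union> snd ` set (take i s) \<and> snd P \<in> \<B> \<union> snd ` set (take i s) \<and>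
      snd (s ! i) = apply_op (fst (s ! i)) (fst P) (snd P)"
  proof
    fix i assume "i \<in> {..<length s}"
    then obtain V W where "V \<in> \<B> \<union> snd ` set (take i s)" "W \<in> \<B> \<union> snd ` set (take i s)"
      and "snd (s ! i) = apply_op (fst (s ! i)) V W"
      using assms unfolding generates_def lessThan_iff by blast
    then show "\<exists>P. fst P \<in> \<B> \<union> snd ` set (take i s) \<and> snd P \<in> \<B> \<union> snd ` set (take i s) \<and>
        snd (s ! i) = apply_op (fst (s ! i)) (fst P) (snd P)"
      by (intro exI[of _ "(V, W)"] conjI) (simp_all only: fst_conv snd_conv)
  qed
  from bchoice[OF this] obtain P where P: "\<forall>i\<in>{..<length s}.
      fst (P i) \<in> \<B> \<union> snd ` set (take i s) \<and> snd (P i) \<in> \<B> \<union> snd ` set (take i s) \<and>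
      snd (s ! i) = apply_op (fst (s ! i)) (fst (P i)) (snd (P i))" ..
  define X where "X = fst \<circ> P"
  define Y where "Y = snd \<circ> P"
  have step: "X i \<in> \<B> \<union> snd ` set (take i s) \<and> Y i \<in> \<B> \<union> snd ` set (take i s) \<and>
      snd (s ! i) = apply_op (fst (s ! i)) (X i) (Y i)" if "i < length s" for i
    unfolding X_def Y_def comp_def using bspec[OF P, of i] that by blast
  define \<Lambda> where "\<Lambda> = (\<lambda>i. (X i \<inter> ?U, Y i \<inter> ?U)) ` ?I"
  have "finite \<Lambda>" unfolding \<Lambda>_def by simp
  moreover have "card \<Lambda> \<le> num_caps s"
    unfolding \<Lambda>_def num_caps_def length_filter_conv_card by (rule card_image_le) simp
  moreover have "cover_collection \<Gamma> A \<B> \<Lambda>"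
    unfolding cover_collection_def
  proof (intro conjI notI)
    show "\<Lambda> \<subseteq> Pow ?U \<times> Pow ?U" unfolding \<Lambda>_def by auto
  next
    assume "\<exists>\<F> a. semi_filter ?U \<F> \<and> preserves \<F> \<Lambda> \<and> a \<in> A \<and> above ?U \<B> \<F> a"
    then obtain \<F> a where sf: "semi_filter ?U \<F>" and pr: "preserves \<F> \<Lambda>"
      and a: "a \<in> A" and ab: "above ?U \<B> \<F> a" by blast
    have pres: "(X i \<inter> ?U) \<inter> (Y i \<inter> ?U) \<in> \<F>"
      if "i < length s" "fst (s ! i) = Cap" "X i \<inter> ?U \<in> \<F>" "Y i \<inter> ?U \<in> \<F>" for i
    proof -
      have "(X i \<inter> ?U, Y i \<inter> ?U) \<in> \<Lambda>" unfolding \<Lambda>_def using that(1,2) by blast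
      then show ?thesis using pr that(3,4) unfolding preserves_def by blast
    qed
    have "s \<noteq> []" and "snd (last s) = A" using assms unfolding generates_def by blast+
    then have last: "length s - 1 < length s" "snd (s ! (length s - 1)) = A"
      by (simp_all add: last_conv_nth)
    \<comment> \<open>This trace is empty because \<open>?U\<close> is the complement of
      \<open>A\<close>, and no semi-filter contains the empty set.\<close>
    have "A \<inter> ?U \<in> \<F>"
      using semi_filter_contains_traces[OF sf ab step pres last(1)] a
      unfolding last(2) by blast
    then show False using sf by (simp add: semi_filter_def)
  qed
  ultimately show thesis using that by blast
qed

theorem theorem3p5:
  fixes \<Gamma> A :: "'a set" and \<B> :: "'a set set"
  assumes "finite \<Gamma>" and "\<Gamma> \<noteq> {}"
    and "A \<subseteq> \<Gamma>" and "A \<noteq> {}" and "A \<noteq> \<Gamma>"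
    and "\<B> \<subseteq> Pow \<Gamma>" and "\<B> \<noteq> {}"
  shows "cover_complexity \<Gamma> A \<B> \<le> D_cap \<Gamma> A \<B>"
  unfolding D_cap_def
\<comment> \<open>Bounding every generating sequence also covers the case where none exists and the
  right-hand side is infinite.\<close>
proof (rule Inf_greatest, clarify)
  fix s assume "generates \<Gamma> \<B> s A"
  then obtain \<Lambda> where \<Lambda>: "finite \<Lambda>" "cover_collection \<Gamma> A \<B> \<Lambda>" "card \<Lambda> \<le> num_caps s"
    by (rule generates_imp_cover_collection)
  have "cover_complexity \<Gamma> A \<B> \<le> enat (card \<Lambda>)"
    unfolding cover_complexity_def using \<Lambda>(1,2) by (intro Inf_lower) blast
  also have "\<dots> \<le> enat (num_caps s)" using \<Lambda>(3) by simp
  finally show "cover_complexity \<Gamma> A \<B> \<le> enat (num_caps s)" .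
qed

end
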